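(* Let $G$ be a bush graph in which every bush has at most two edges. Then the expected weight of the greedy matching returned by the algorithm \textsc{Rgma} on $G$ is at least $\frac{2}{3}\,\mathrm{OPT}(G)$.
   Context: Graphs are finite, simple, undirected, with positive edge weights; the weight of a matching is the sum of its edge weights. With distinct edge weights $w_1>\dots>w_\ell$, a greedy matching is any matching that can be output by: $\mathcal{M}\leftarrow\emptyset$; for $i=1,\dots,\ell$, while the current edge set contains an edge of weight $w_i$, pick any such edge $e^*$, add it to $\mathcal{M}$ and delete all edges sharing an endpoint with $e^*$. $\mathrm{OPT}(G)$ is the maximum weight of a greedy matching of $G$. $G$ is a bush graph if for every $i$ the edges of weight $w_i$ form a star (all share a common vertex, the center); this star is the $i$-th bush. Algorithm \textsc{Rgma} on a bush graph: $\mathcal{M}\leftarrow\emptyset$; for $i=1,\dots,\ell$: let $G_i$ be the set of edges of weight $w_i$ still present in the current graph; if $G_i\neq\emptyset$, select an edge $e_i\in G_i$ uniformly at random, add it to $\mathcal{M}$, and delete from the current graph both endpoints of $e_i$ (with their incident edges) and all edges of $G_i$. Output $\mathcal{M}$. *)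

theory Defs
  imports "HOL-Probability.Probability"
begin

text \<open>
  A graph is a vertex set \<^term>\<open>V\<close> with a set \<^term>\<open>E\<close> of two-element subsets of
  \<^term>\<open>V\<close>; being simple is built into this representation. The weight function is
  total, but only its values on \<^term>\<open>E\<close> matter.
\<close>

definition weighted_graph :: "'a set \<Rightarrow> 'a set set \<Rightarrow> ('a set \<Rightarrow> real) \<Rightarrow> bool" where
  "weighted_graph V E w \<longleftrightarrow>
     finite V \<and> (\<forall>e\<in>E. e \<subseteq> V \<and> card e = 2) \<and> (\<forall>e\<in>E. w e > 0)"

definition matching_weight :: "('a set \<Rightarrow> real) \<Rightarrow> 'a set set \<Rightarrow> real" where
  "matching_weight w M = (\<Sum>e\<in>M. w e)"

definition edge_weights_desc :: "'a set set \<Rightarrow> ('a set \<Rightarrow> real) \<Rightarrow> real list" where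
  "edge_weights_desc E w = rev (sorted_list_of_set (w ` E))"

definition edges_of_weight :: "('a set \<Rightarrow> real) \<Rightarrow> real \<Rightarrow> 'a set set \<Rightarrow> 'a set set" where
  "edges_of_weight w x F = {e \<in> F. w e = x}"

text \<open>
  Edges of \<^term>\<open>F\<close> surviving the deletion of both endpoints of \<^term>\<open>e\<close>; since edges
  are nonempty, \<^term>\<open>e\<close> itself does not survive.
\<close>

definition delete_endpoints :: "'a set \<Rightarrow> 'a set set \<Rightarrow> 'a set set" where
  "delete_endpoints e F = {f \<in> F. f \<inter> e = {}}"

text \<open>
  States are pairs of the matching built so far and the current edge set.
  \<^term>\<open>greedy_while w x s t\<close> holds iff some execution of the while loop for weight
  \<^term>\<open>x\<close> leads from \<^term>\<open>s\<close> to \<^term>\<open>t\<close>.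
\<close>

inductive greedy_while ::
  "('a set \<Rightarrow> real) \<Rightarrow> real \<Rightarrow> 'a set set \<times> 'a set set \<Rightarrow> 'a set set \<times> 'a set set \<Rightarrow> bool"
  for w x where
  exit: "edges_of_weight w x F = {} \<Longrightarrow> greedy_while w x (M, F) (M, F)"
| pick: "e \<in> edges_of_weight w x F \<Longrightarrow>
         greedy_while w x (insert e M, delete_endpoints e F) t \<Longrightarrow>
         greedy_while w x (M, F) t"

inductive greedy_for ::
  "('a set \<Rightarrow> real) \<Rightarrow> real list \<Rightarrow> 'a set set \<times> 'a set set \<Rightarrow> 'a set set \<times> 'a set set \<Rightarrow> bool"
  for w where
  Nil: "greedy_for w [] s s"
| Cons: "greedy_while w x s t \<Longrightarrow> greedy_for w xs t u \<Longrightarrow> greedy_for w (x # xs) s u"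

definition greedy_matching :: "'a set set \<Rightarrow> ('a set \<Rightarrow> real) \<Rightarrow> 'a set set \<Rightarrow> bool" where
  "greedy_matching E w M \<longleftrightarrow> (\<exists>F. greedy_for w (edge_weights_desc E w) ({}, E) (M, F))"

definition OPT :: "'a set set \<Rightarrow> ('a set \<Rightarrow> real) \<Rightarrow> real" where
  "OPT E w = Max (matching_weight w ` {M. greedy_matching E w M})"

definition bush_graph :: "'a set set \<Rightarrow> ('a set \<Rightarrow> real) \<Rightarrow> bool" where
  "bush_graph E w \<longleftrightarrow> (\<forall>x \<in> w ` E. \<exists>c. \<forall>e \<in> edges_of_weight w x E. c \<in> e)"

fun rgma_for ::
  "('a set \<Rightarrow> real) \<Rightarrow> real list \<Rightarrow> 'a set set \<times> 'a set set \<Rightarrow> 'a set set pmf" where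
  "rgma_for w [] (M, F) = return_pmf M"
| "rgma_for w (x # xs) (M, F) =
     (let G = edges_of_weight w x F in
      if G = {} then rgma_for w xs (M, F)
      else pmf_of_set G \<bind> (\<lambda>e. rgma_for w xs (insert e M, delete_endpoints e F - G)))"

definition rgma :: "'a set set \<Rightarrow> ('a set \<Rightarrow> real) \<Rightarrow> 'a set set pmf" where
  "rgma E w = rgma_for w (edge_weights_desc E w) ({}, E)"

text \<open>The next two facts make the \<^const>\<open>Max\<close> in \<^const>\<open>OPT\<close> meaningful.\<close>

lemma greedy_for_subset:
  assumes "greedy_for w xs s t"
  shows "fst t \<subseteq> fst s \<union> snd s \<and> snd t \<subseteq> snd s"
proof -
  have *: "fst t \<subseteq> fst s \<union> snd s \<and> snd t \<subseteq> snd s" if "greedy_while w x s t" for x s t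
    using that
    by (induction rule: greedy_while.induct) (auto simp: edges_of_weight_def delete_endpoints_def)
  show ?thesis
    using assms by (induction rule: greedy_for.induct) (use * in blast)+
qed

lemma finite_greedy_matchings:
  assumes "weighted_graph V E w"
  shows "finite {M. greedy_matching E w M}"
proof -
  have "E \<subseteq> Pow V" "finite V"
    using assms by (auto simp: weighted_graph_def)
  hence "finite E"
    by (meson finite_Pow_iff finite_subset)
  moreover have "{M. greedy_matching E w M} \<subseteq> Pow E"
    using greedy_for_subset by (fastforce simp: greedy_matching_def)
  ultimately show ?thesis
    by (meson finite_Pow_iff finite_subset)
qed

lemma greedy_matching_exists:
  assumes "weighted_graph V E w"
  shows "\<exists>M. greedy_matching E w M"
proof -
  have fin: "finite E"
    using assms unfolding weighted_graph_def
    by (meson PowI finite_Pow_iff finite_subset subsetI)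
  have ne: "{} \<notin> E"
    using assms by (auto simp: weighted_graph_def)
  have while_ex: "\<exists>t. greedy_while w x (M, F) t" if "finite F" "{} \<notin> F" for x M F
    using that
  proof (induction "card F" arbitrary: M F rule: less_induct)
    case less
    show ?case
    proof (cases "edges_of_weight w x F = {}")
      case True
      thus ?thesis by (blast intro: greedy_while.exit)
    next
      case False
      then obtain e where e: "e \<in> edges_of_weight w x F" by blast
      hence "e \<in> F" "e \<noteq> {}"
        using less.prems by (auto simp: edges_of_weight_def)
      hence "delete_endpoints e F \<subset> F"
        unfolding delete_endpoints_def by blast
      moreover from this have "finite (delete_endpoints e F)" "{} \<notin> delete_endpoints e F"
        using less.prems by (auto intro: finite_subset)
      ultimately show ?thesis
        using less.hyps less.prems e by (meson greedy_while.pick psubset_card_mono)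
    qed
  qed
  have "\<exists>t. greedy_for w xs (M, F) t" if "finite F" "{} \<notin> F" for xs M F
    using that
  proof (induction xs arbitrary: M F)
    case Nil
    show ?case by (blast intro: greedy_for.Nil)
  next
    case (Cons x xs)
    obtain M' F' where t: "greedy_while w x (M, F) (M', F')"
      using while_ex[OF Cons.prems] by (metis surj_pair)
    hence "greedy_for w [x] (M, F) (M', F')"
      by (blast intro: greedy_for.intros)
    hence "F' \<subseteq> F"
      using greedy_for_subset by fastforce
    thus ?case
      using Cons t by (meson greedy_for.Cons finite_subset subsetD)
  qed
  with fin ne show ?thesis
    unfolding greedy_matching_def by (metis surj_pair)
qed

end

theory Submission
  imports Defs
begin

text \<open>
  In a bush graph, deleting a vertex lowers the optimum by at least 0 and at most the largest
  weight present. If the heaviest bush has two edges \<open>{c, a}\<close> and \<open>{c, b}\<close>, their common weight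
  being \<open>x\<close>, the optima after picking either of them therefore differ by at most \<open>x\<close>. The uniform
  choice thus loses at most \<open>x / 2\<close> on average, so with the factor \<open>2 / 3\<close> on the remaining graph
  it loses at most \<open>x / 3\<close>, which is paid for by the edge of weight \<open>x\<close> just gained.
\<close>

section \<open>The optimum as a recursion over the weights\<close>

text \<open>Quantifying over every real \<open>x\<close>, whether or not it occurs as a weight,
  makes the property pass to all subsets of the edges, as the inductions over shrinking graphs
  require.\<close>

definition bush_edges :: "('a set \<Rightarrow> real) \<Rightarrow> 'a set set \<Rightarrow> bool" where
  "bush_edges w F \<longleftrightarrow> finite F \<and> (\<forall>e\<in>F. card e = 2) \<and>
     (\<forall>x. \<exists>c. \<forall>e\<in>edges_of_weight w x F. c \<in> e)"

text \<open>At each weight one edge is taken if any is present. In a bush graph this is exactly the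
  freedom of a greedy run.\<close>

fun opt :: "('a set \<Rightarrow> real) \<Rightarrow> real list \<Rightarrow> 'a set set \<Rightarrow> real" where
  "opt w [] F = 0"
| "opt w (x # xs) F =
     (if edges_of_weight w x F = {} then opt w xs F
      else x + Max ((\<lambda>e. opt w xs (delete_endpoints e F)) ` edges_of_weight w x F))"

lemma delete_endpoints_delete_endpoints:
  "delete_endpoints S (delete_endpoints T F) = delete_endpoints (S \<union> T) F"
  by (auto simp: delete_endpoints_def)

lemma delete_endpoints_subset: "delete_endpoints S F \<subseteq> F"
  by (auto simp: delete_endpoints_def)

lemma bush_edges_mono: "bush_edges w F \<Longrightarrow> F' \<subseteq> F \<Longrightarrow> bush_edges w F'"
  unfolding bush_edges_def edges_of_weight_def
  by (auto intro: finite_subset) (metis subsetD)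

lemma bush_edges_delete: "bush_edges w F \<Longrightarrow> bush_edges w (delete_endpoints S F)"
  using bush_edges_mono delete_endpoints_subset by blast

lemma finite_bush: "bush_edges w F \<Longrightarrow> finite (edges_of_weight w x F)"
  by (simp add: bush_edges_def edges_of_weight_def)

lemma opt_ge:
  assumes "bush_edges w F" "e \<in> edges_of_weight w x F"
  shows "x + opt w xs (delete_endpoints e F) \<le> opt w (x # xs) F"
  using assms finite_bush[OF assms(1), of x] by auto

lemma opt_attained:
  assumes "bush_edges w F" "edges_of_weight w x F \<noteq> {}"
  obtains e where "e \<in> edges_of_weight w x F"
    "opt w (x # xs) F = x + opt w xs (delete_endpoints e F)"
proof -
  let ?S = "(\<lambda>e. opt w xs (delete_endpoints e F)) ` edges_of_weight w x F"
  have "Max ?S \<in> ?S"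
    using assms finite_bush by (intro Max_in) auto
  thus ?thesis
    using that assms(2) by auto
qed

section \<open>Effect of deleting a vertex on the optimum\<close>

lemma doubleton_other:
  assumes "card e = 2" "v \<in> e"
  obtains u where "e = {v, u}" "u \<noteq> v"
  using assms by (auto simp: card_2_iff doubleton_eq_iff)

text \<open>Induction on the weights: an optimal first pick in one graph is imitated in the other.
  Where \<open>v\<close> prevents this, the remaining graphs differ by one further vertex, whose
  effect is controlled by the induction hypothesis.\<close>

lemma opt_delete_vertex:
  assumes "bush_edges w F" "sorted_wrt (\<ge>) xs" "\<forall>x\<in>set xs. 0 < x \<and> x \<le> B" "0 \<le> B"
  shows "opt w xs (delete_endpoints {v} F) \<le> opt w xs F \<and>
         opt w xs F \<le> opt w xs (delete_endpoints {v} F) + B"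
  using assms
proof (induction xs arbitrary: F v B)
  case Nil
  thus ?case by simp
next
  case (Cons x xs)
  let ?D = delete_endpoints
  let ?F' = "?D {v} F"
  let ?G = "edges_of_weight w x F" and ?G' = "edges_of_weight w x ?F'"
  note bF = \<open>bush_edges w F\<close>
  have bF': "bush_edges w ?F'"
    by (rule bush_edges_delete[OF bF])
  have xB: "0 < x" "x \<le> B"
    using Cons.prems by auto
  \<comment> \<open>The list is descending, so the remaining weights are bounded by \<open>x\<close>
    as well as by \<open>B\<close>. The bound \<open>x\<close> lets a lost vertex be weighed against
    a picked edge of weight \<open>x\<close>.\<close>
  have IH: "opt w xs (?D {u} H) \<le> opt w xs H" "opt w xs H \<le> opt w xs (?D {u} H) + C"
    if "bush_edges w H" "C = x \<or> C = B" for H u C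
    using Cons.IH[OF that(1), of C u] Cons.prems that(2) by auto
  have G': "?G' = {e \<in> ?G. v \<notin> e}"
    by (auto simp: edges_of_weight_def delete_endpoints_def)
  have card2: "card e = 2" if "e \<in> ?G" for e
    using that bF by (auto simp: edges_of_weight_def bush_edges_def)
  have comm: "?D e ?F' = ?D {v} (?D e F)" for e
    by (simp add: delete_endpoints_delete_endpoints Un_commute)
  have via: "?D {v, u} F = ?D {u} ?F'" for u
    by (simp add: delete_endpoints_delete_endpoints insert_commute)
  show ?case
  proof
    show "opt w (x # xs) ?F' \<le> opt w (x # xs) F"
    proof (cases "?G' = {}")
      case False
      then obtain e where e: "e \<in> ?G'"
        "opt w (x # xs) ?F' = x + opt w xs (?D e ?F')"
        using opt_attained[OF bF'] by blast
      have "opt w xs (?D e ?F') \<le> opt w xs (?D e F)"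
        unfolding comm using IH(1) bush_edges_delete[OF bF] by blast
      moreover have "x + opt w xs (?D e F) \<le> opt w (x # xs) F"
        using e(1) G' by (intro opt_ge[OF bF]) auto
      ultimately show ?thesis
        using e(2) by linarith
    next
      case empty: True
      show ?thesis
      proof (cases "?G = {}")
        case True
        thus ?thesis using empty IH(1)[OF bF, of B v] by simp
      next
        case False
        then obtain e where e: "e \<in> ?G" "v \<in> e"
          using empty G' by auto
        then obtain u where u: "e = {v, u}"
          using doubleton_other card2 by metis
        \<comment> \<open>All edges of weight \<open>x\<close> contain \<open>v\<close>. Picking one
          in \<open>F\<close> also costs the vertex \<open>u\<close>, which is worth at most
          \<open>x\<close> later and is repaid by the edge.\<close>
        have "opt w xs ?F' \<le> opt w xs (?D e F) + x"
          unfolding u via using IH(2)[OF bF', of x] by blast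
        moreover have "x + opt w xs (?D e F) \<le> opt w (x # xs) F"
          by (rule opt_ge[OF bF e(1)])
        ultimately show ?thesis
          using empty by simp
      qed
    qed
    show "opt w (x # xs) F \<le> opt w (x # xs) ?F' + B"
    proof (cases "?G = {}")
      case True
      thus ?thesis using G' IH(2)[OF bF, of B v] by simp
    next
      case False
      then obtain e where e: "e \<in> ?G"
        "opt w (x # xs) F = x + opt w xs (?D e F)"
        using opt_attained[OF bF] by blast
      show ?thesis
      proof (cases "v \<in> e")
        case False
        have "opt w xs (?D e F) \<le> opt w xs (?D e ?F') + B"
          unfolding comm using IH(2) bush_edges_delete[OF bF] by blast
        moreover have "x + opt w xs (?D e ?F') \<le> opt w (x # xs) ?F'"
          using e(1) False G' by (intro opt_ge[OF bF']) auto
        ultimately show ?thesis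
          using e(2) by linarith
      next
        case True
        then obtain u where u: "e = {v, u}"
          using doubleton_other card2[OF e(1)] by metis
        show ?thesis
        proof (cases "?G' = {}")
          case True
          \<comment> \<open>Without \<open>v\<close> the weight \<open>x\<close> is lost, but
            \<open>u\<close> is kept, so monotonicity covers the later weights.\<close>
          have "opt w xs (?D e F) \<le> opt w xs ?F'"
            unfolding u via using IH(1)[OF bF'] by blast
          thus ?thesis
            using e(2) True xB by simp
        next
          case False
          then obtain f where f: "f \<in> ?G'" by blast
          hence f': "f \<in> ?G" "v \<notin> f" using G' by auto
          obtain c where c: "\<forall>e\<in>?G. c \<in> e"
            using bF unfolding bush_edges_def by blast
          \<comment> \<open>The center lies in both \<open>e\<close> and \<open>f\<close>, and
            \<open>v\<close> is not in \<open>f\<close>.\<close>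
          have "c = u"
            using c e(1) f' u by auto
          hence "u \<in> f"
            using c f'(1) by blast
          then obtain t where t: "f = {u, t}"
            using doubleton_other card2[OF f'(1)] by metis
          \<comment> \<open>Replacing \<open>e\<close> by \<open>f\<close> keeps the gain
            \<open>x\<close>; the remaining graphs then differ only in the vertex
            \<open>t\<close>.\<close>
          have eq: "?D f ?F' = ?D {t} (?D e F)"
            by (auto simp: t u delete_endpoints_def)
          have "opt w xs (?D e F) \<le> opt w xs (?D f ?F') + x"
            unfolding eq using IH(2) bush_edges_delete[OF bF] by blast
          moreover have "x + opt w xs (?D f ?F') \<le> opt w (x # xs) ?F'"
            by (rule opt_ge[OF bF' f])
          ultimately show ?thesis
            using e(2) xB by linarith
        qed
      qed
    qed
  qed
qed

section \<open>Greedy matchings in bush graphs\<close>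

lemma bush_delete_edge:
  assumes "bush_edges w F" "e \<in> edges_of_weight w x F"
  shows "edges_of_weight w x (delete_endpoints e F) = {}"
  using assms unfolding bush_edges_def edges_of_weight_def delete_endpoints_def by blast

text \<open>A pick covers the center and so destroys the whole star: the loop body runs at most
  once, in step with the recursion of \<open>opt\<close>.\<close>

lemma greedy_while_bush:
  assumes "greedy_while w x (M, F) t" "bush_edges w F"
  shows "edges_of_weight w x F = {} \<and> t = (M, F) \<or>
         (\<exists>e\<in>edges_of_weight w x F. t = (insert e M, delete_endpoints e F))"
  using assms(1)
proof cases
  case exit
  thus ?thesis by simp
next
  case (pick e)
  from pick(2) have "t = (insert e M, delete_endpoints e F)"
    by cases (use bush_delete_edge[OF assms(2) pick(1)] in auto)
  thus ?thesis using pick(1) by blast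
qed

lemma edge_notin_delete_endpoints:
  "bush_edges w F \<Longrightarrow> e \<notin> delete_endpoints e F"
  by (force simp: bush_edges_def delete_endpoints_def)

lemma matching_weight_insert:
  assumes "finite M" "M \<inter> F = {}" "e \<in> edges_of_weight w x F"
  shows "matching_weight w (insert e M) = x + matching_weight w M"
proof -
  have "e \<notin> M" "w e = x"
    using assms(2,3) by (auto simp: edges_of_weight_def)
  thus ?thesis
    using assms(1) by (simp add: matching_weight_def)
qed

text \<open>Bounds \<open>OPT\<close> by \<open>opt\<close>. Disjointness of \<open>M\<close> and
  \<open>F\<close> is the invariant that makes every picked edge new, so that its weight really adds
  to the total.\<close>

lemma greedy_for_le_opt:
  assumes "greedy_for w xs (M, F) (M', F')" "bush_edges w F" "finite M" "M \<inter> F = {}"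
  shows "matching_weight w M' \<le> matching_weight w M + opt w xs F"
  using assms
proof (induction xs arbitrary: M F)
  case Nil
  thus ?case by (auto elim: greedy_for.cases)
next
  case (Cons x xs)
  from Cons.prems(1) obtain t where t: "greedy_while w x (M, F) t" "greedy_for w xs t (M', F')"
    by (auto elim: greedy_for.cases)
  consider (none) "edges_of_weight w x F = {}" "t = (M, F)"
    | (edge) e where "e \<in> edges_of_weight w x F" "t = (insert e M, delete_endpoints e F)"
    using greedy_while_bush[OF t(1) Cons.prems(2)] by blast
  thus ?case
  proof cases
    case none
    thus ?thesis using Cons t by simp
  next
    case edge
    have "matching_weight w M' \<le>
        matching_weight w (insert e M) + opt w xs (delete_endpoints e F)"
      using t(2) edge(2) Cons.prems edge_notin_delete_endpoints[OF Cons.prems(2)]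
        delete_endpoints_subset[of e F]
      by (intro Cons.IH bush_edges_delete) auto
    also have "\<dots> = matching_weight w M + (x + opt w xs (delete_endpoints e F))"
      using matching_weight_insert[OF Cons.prems(3,4) edge(1)] by simp
    also have "\<dots> \<le> matching_weight w M + opt w (x # xs) F"
      using opt_ge[OF Cons.prems(2) edge(1)] by simp
    finally show ?thesis .
  qed
qed

section \<open>Expected weight of the random matching\<close>

text \<open>Finite support allows the expectation after a uniform choice to be expanded into a
  finite average.\<close>

lemma finite_set_rgma_for:
  "finite F \<Longrightarrow> finite (set_pmf (rgma_for w xs (M, F)))"
proof (induction xs arbitrary: M F)
  case (Cons x xs)
  have "finite (edges_of_weight w x F)"
    using Cons.prems by (simp add: edges_of_weight_def)
  moreover have "finite (delete_endpoints e F - edges_of_weight w x F)" for e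
    using Cons.prems by (simp add: delete_endpoints_def)
  ultimately show ?case
    using Cons by (auto simp: Let_def set_pmf_of_set)
qed simp

text \<open>Both remaining graphs arise from \<open>F\<close> without the center \<open>c\<close> by
  deleting one more vertex, so both optima lie at most \<open>x\<close> below the optimum of that
  common graph, and never above it.\<close>

lemma opt_delete_bush_edges:
  assumes "bush_edges w F" "sorted_wrt (\<ge>) (x # xs)" "\<forall>y\<in>set (x # xs). 0 < y"
    and "e \<in> edges_of_weight w x F" "f \<in> edges_of_weight w x F"
  shows "opt w xs (delete_endpoints e F) \<le> opt w xs (delete_endpoints f F) + x"
proof -
  let ?D = delete_endpoints
  obtain c where "c \<in> e" "c \<in> f"
    using assms unfolding bush_edges_def by metis
  moreover have "card e = 2" "card f = 2"
    using assms by (auto simp: bush_edges_def edges_of_weight_def)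
  ultimately obtain a b where ab: "e = {c, a}" "f = {c, b}"
    using doubleton_other by metis
  have e: "?D e F = ?D {a} (?D {c} F)" and f: "?D f F = ?D {b} (?D {c} F)"
    by (auto simp: ab delete_endpoints_def)
  have "\<forall>y\<in>set xs. 0 < y \<and> y \<le> x" "0 \<le> x" "sorted_wrt (\<ge>) xs"
    using assms(2,3) by auto
  note lip = opt_delete_vertex[OF bush_edges_delete[OF assms(1)] this(3,1,2), of _ "{c}"]
  show ?thesis
    using lip[of a] lip[of b] unfolding e f by linarith
qed

lemma rgma_for_ge:
  assumes "bush_edges w F" "\<forall>x. card (edges_of_weight w x F) \<le> 2"
    and "sorted_wrt (\<ge>) xs" "\<forall>x\<in>set xs. 0 < x" "finite M" "M \<inter> F = {}"
  shows "measure_pmf.expectation (rgma_for w xs (M, F)) (matching_weight w)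
           \<ge> matching_weight w M + 2 / 3 * opt w xs F"
  using assms
proof (induction xs arbitrary: M F)
  case Nil
  thus ?case by simp
next
  case (Cons x xs)
  let ?D = delete_endpoints
  let ?G = "edges_of_weight w x F"
  let ?Ex = "\<lambda>p. measure_pmf.expectation p (matching_weight w)"
  note bF = \<open>bush_edges w F\<close>
  show ?case
  proof (cases "?G = {}")
    case True
    thus ?thesis using Cons by simp
  next
    case False
    note finG = finite_bush[OF bF, of x]
    have x: "x > 0" using Cons.prems by simp
    \<comment> \<open>Deleting the endpoints of \<open>e\<close> clears its bush, so
      \<open>rgma_for\<close> and \<open>opt\<close> continue on the same edge set.\<close>
    have D: "?D e F - ?G = ?D e F" if "e \<in> ?G" for e
      using bush_delete_edge[OF bF that] by (auto simp: edges_of_weight_def delete_endpoints_def)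
    define p where "p = (\<lambda>e. rgma_for w xs (insert e M, ?D e F - ?G))"
    have step: "?Ex (p e) \<ge> matching_weight w M + x + 2 / 3 * opt w xs (?D e F)"
      if e: "e \<in> ?G" for e
    proof -
      have "card (edges_of_weight w y (?D e F)) \<le> 2" for y
      proof -
        have "card (edges_of_weight w y (?D e F)) \<le> card (edges_of_weight w y F)"
          using finite_bush[OF bF]
          by (intro card_mono) (auto simp: edges_of_weight_def delete_endpoints_def)
        thus ?thesis using Cons.prems(2) le_trans by blast
      qed
      hence "?Ex (p e) \<ge> matching_weight w (insert e M) + 2 / 3 * opt w xs (?D e F)"
        unfolding p_def D[OF e]
        using Cons.prems edge_notin_delete_endpoints[OF bF] delete_endpoints_subset[of e F]
        by (intro Cons.IH bush_edges_delete) auto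
      thus ?thesis
        using matching_weight_insert[OF Cons.prems(5,6) e] by simp
    qed
    have "finite F"
      using bF by (simp add: bush_edges_def)
    hence "finite (set_pmf (p e))" for e
      unfolding p_def by (intro finite_set_rgma_for) (simp add: delete_endpoints_def)
    moreover have "rgma_for w (x # xs) (M, F) = pmf_of_set ?G \<bind> p"
      using False by (simp add: Let_def p_def)
    ultimately have "?Ex (rgma_for w (x # xs) (M, F)) = (\<Sum>e\<in>?G. ?Ex (p e)) / card ?G"
      using False finG
      by (simp add: pmf_expectation_bind_pmf_of_set divide_inverse sum_distrib_left mult.commute)
    also have "\<dots> \<ge> matching_weight w M + 2 / 3 * opt w (x # xs) F"
    proof -
      obtain e where e: "e \<in> ?G" "opt w (x # xs) F = x + opt w xs (?D e F)"
        using opt_attained[OF bF False] by blast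
      show ?thesis
      proof (cases "?G = {e}")
        case True
        show ?thesis
          unfolding e(2) using True x step[OF e(1)] by (simp add: field_simps)
      next
        case False
        then obtain f where f: "f \<in> ?G" "f \<noteq> e"
          using e(1) by blast
        have "{e, f} = ?G"
          using e(1) f finG spec[OF Cons.prems(2), of x] by (intro card_seteq) auto
        hence G: "?G = {e, f}" by simp
        \<comment> \<open>Writing \<open>p\<close> and \<open>q\<close> for the optima after
          \<open>e\<close> and \<open>f\<close>, the average gain is at least
          \<open>x + (p + q) / 3\<close>. With \<open>q \<ge> p - x\<close> this is at least
          \<open>2 / 3 * (x + p)\<close>.\<close>
        have "opt w xs (?D e F) \<le> opt w xs (?D f F) + x"
          using opt_delete_bush_edges[OF bF Cons.prems(3,4) e(1) f(1)] .
        thus ?thesis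
          unfolding e(2) using step[OF e(1)] step[OF f(1)] f(2) by (simp add: G field_simps)
      qed
    qed
    finally show ?thesis .
  qed
qed

theorem theorem9:
  fixes V :: "'a set" and E :: "'a set set" and w :: "'a set \<Rightarrow> real"
  assumes "weighted_graph V E w"
    and "bush_graph E w"
    and "\<forall>x \<in> w ` E. card (edges_of_weight w x E) \<le> 2"
  shows "measure_pmf.expectation (rgma E w) (matching_weight w) \<ge> 2 / 3 * OPT E w"
proof -
  have finE: "finite E"
    using assms(1) unfolding weighted_graph_def
    by (meson PowI finite_Pow_iff finite_subset subsetI)
  \<comment> \<open>Absent weights have empty bushes, which extends both bush hypotheses from the
    occurring weights to all reals.\<close>
  have none: "edges_of_weight w x E = {}" if "x \<notin> w ` E" for x
    using that by (auto simp: edges_of_weight_def)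
  have bE: "bush_edges w E"
    using assms(1,2) finE none unfolding bush_edges_def weighted_graph_def bush_graph_def
    by (metis empty_iff)
  have card: "\<forall>x. card (edges_of_weight w x E) \<le> 2"
    using assms(3) none by (metis card.empty zero_le)
  have "sorted_wrt (\<ge>) (edge_weights_desc E w)"
    by (simp add: edge_weights_desc_def sorted_wrt_rev)
  moreover have "\<forall>x\<in>set (edge_weights_desc E w). 0 < x"
    using assms(1) finE by (auto simp: edge_weights_desc_def weighted_graph_def)
  ultimately have "measure_pmf.expectation (rgma E w) (matching_weight w)
      \<ge> 2 / 3 * opt w (edge_weights_desc E w) E"
    using rgma_for_ge[OF bE card, of "edge_weights_desc E w" "{}"]
    by (simp add: rgma_def matching_weight_def)
  moreover have "OPT E w \<le> opt w (edge_weights_desc E w) E"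
  proof -
    have "matching_weight w M \<le> opt w (edge_weights_desc E w) E" if "greedy_matching E w M" for M
      using that greedy_for_le_opt[OF _ bE, of "edge_weights_desc E w" "{}"]
      by (auto simp: greedy_matching_def matching_weight_def)
    thus ?thesis
      unfolding OPT_def
      using finite_greedy_matchings[OF assms(1)] greedy_matching_exists[OF assms(1)]
      by (subst Max_le_iff) auto
  qed
  ultimately show ?thesis by linarith
qed

end
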